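(* Let $N\ge1$ and let $f\colon\{\pm1\}^N\to[-1,1]$ be a function of degree $d$. Then $$\Big(\sum_{0<|S|\le d}|\widehat f(S)|^2\Big)^{\frac12}\le 2e^d\,(1-|\widehat f(\emptyset)|),$$ where the sum is over subsets $S\subset[N]$ with $0<|S|\le d$.
   Context: Here $[N]=\{1,\dots,N\}$, and for $f\colon\{\pm1\}^N\to\mathbb{R}$ and $S\subset[N]$ the Fourier coefficient is $\widehat f(S)=2^{-N}\sum_{x\in\{\pm1\}^N}f(x)\,x^S$, with $x^S=\prod_{k\in S}x_k$ and $x^\emptyset=1$, so that $f(x)=\sum_{S\subset[N]}\widehat f(S)x^S$. The degree of a nonzero $f$ is $\deg f=\max\{|S|:\widehat f(S)\neq0\}$; the zero function has degree $0$. *)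

theory Defs
  imports Complex_Main "HOL-Library.FuncSet"
begin

(* A point of the cube is an extensional function on {1..N}; a function on the cube is
   a total function of type (nat => real) => real of which only the values on
   hypercube N are ever used. *)
definition hypercube :: "nat \<Rightarrow> (nat \<Rightarrow> real) set" where
  "hypercube N = {1..N} \<rightarrow>\<^sub>E {-1, 1}"

definition walsh :: "nat set \<Rightarrow> (nat \<Rightarrow> real) \<Rightarrow> real" where
  "walsh S x = (\<Prod>k\<in>S. x k)"

definition fourier_coeff :: "nat \<Rightarrow> ((nat \<Rightarrow> real) \<Rightarrow> real) \<Rightarrow> nat set \<Rightarrow> real" where
  "fourier_coeff N f S = (1 / 2 ^ N) * (\<Sum>x\<in>hypercube N. f x * walsh S x)"

(* For f nonzero on the cube, the set under Max is finite and, by Fourier inversion,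
   nonempty. *)
definition cube_degree :: "nat \<Rightarrow> ((nat \<Rightarrow> real) \<Rightarrow> real) \<Rightarrow> nat" where
  "cube_degree N f =
     (if \<forall>x\<in>hypercube N. f x = 0 then 0
      else Max {card S | S. S \<subseteq> {1..N} \<and> fourier_coeff N f S \<noteq> 0})"

end

theory Submission
  imports Defs "HOL-Analysis.Convex"
begin

text \<open>
  Let \<open>\<sigma> = \<plusminus>1\<close> be the sign of the mean of \<open>f\<close> and put \<open>g = 1 - \<sigma> f\<close>. Since \<open>\<bar>f\<bar> \<le> 1\<close>, the
  function \<open>g\<close> is nonnegative, so its \<open>L\<^sup>1\<close> norm for the uniform measure is its mean,
  which is \<open>1 - \<bar>f^({})\<bar>\<close>. Up to sign, \<open>f\<close> and \<open>g\<close> have the same Fourier coefficients at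
  nonempty sets, so by Parseval the left side of the claim is at most the \<open>L\<^sup>2\<close> norm of \<open>g\<close>.
  It remains to compare these two norms for a function of degree at most \<open>d\<close>, and
  \<open>L2_le_exp_degree_L1\<close> does so with the constant \<open>e\<^sup>d\<close>.

  That comparison is an endpoint form of hypercontractivity, and it follows directly from the
  logarithmic Sobolev inequality \<open>log_sobolev\<close>, which says that
  \<open>Ent (g\<^sup>2) \<le> 2 \<Sum> \<bar>S\<bar> g^(S)\<^sup>2\<close>. If \<open>g\<close> has degree at most \<open>d\<close> and \<open>L\<^sup>2\<close> norm \<open>1\<close>, the
  right side is at most \<open>2 d\<close>, so \<open>ln (1 / \<bar>g\<bar>)\<close> has mean at least \<open>- d\<close> under the
  probability density \<open>g\<^sup>2\<close>. By Jensen's inequality, \<open>1 / \<bar>g\<bar>\<close> then has mean at least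
  \<open>e\<close> to the power \<open>- d\<close> under that density, and this mean is the \<open>L\<^sup>1\<close> norm of \<open>g\<close>.

  The logarithmic Sobolev inequality is proved by induction on the dimension. Cutting the
  cube along its last coordinate, the entropy is the average of the entropies of the two halves
  plus the entropy of the two numbers \<open>A, B\<close> that are the mean squares on the halves. By the
  two-point inequality \<open>two_point_log_sobolev\<close>, the latter is at most
  \<open>(\<surd>A - \<surd>B)\<^sup>2 / 2\<close>, hence at most half the mean squared difference of the two halves, and
  this is exactly twice what the last coordinate adds to the energy.
\<close>

section \<open>Averages over the cube\<close>

definition cube_mean :: "nat \<Rightarrow> ((nat \<Rightarrow> real) \<Rightarrow> real) \<Rightarrow> real" where
  "cube_mean N f = (\<Sum>x\<in>hypercube N. f x) / 2 ^ N"

text \<open>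
  Coordinates are numbered from \<open>1\<close>, so \<open>Suc N\<close> is the last coordinate of the cube of
  dimension \<open>Suc N\<close>; fixing it gives a function on the cube of dimension \<open>N\<close>.
\<close>

definition restrict_last :: "nat \<Rightarrow> real \<Rightarrow> ((nat \<Rightarrow> real) \<Rightarrow> real) \<Rightarrow> (nat \<Rightarrow> real) \<Rightarrow> real" where
  "restrict_last N s f = (\<lambda>x. f (x(Suc N := s)))"

lemma finite_hypercube [simp]: "finite (hypercube N)"
  unfolding hypercube_def by (intro finite_PiE) auto

lemma cube_mean_0: "cube_mean 0 f = f (\<lambda>_. undefined)"
  by (simp add: cube_mean_def hypercube_def)

lemma sum_hypercube_Suc:
  "(\<Sum>x\<in>hypercube (Suc N). f x)
     = (\<Sum>x\<in>hypercube N. f (x(Suc N := 1))) + (\<Sum>x\<in>hypercube N. f (x(Suc N := -1)))"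
proof -
  let ?h = "\<lambda>(s :: real, x :: nat \<Rightarrow> real). x(Suc N := s)"
  have "{1..Suc N} = insert (Suc N) {1..N}" by auto
  then have cube: "hypercube (Suc N) = ?h ` ({-1, 1} \<times> hypercube N)"
    by (simp only: hypercube_def PiE_insert_eq)
  have inj: "inj_on ?h ({-1, 1} \<times> hypercube N)"
    unfolding hypercube_def by (rule inj_combinator) simp
  have "(\<Sum>x\<in>hypercube (Suc N). f x) = (\<Sum>p\<in>{-1, 1} \<times> hypercube N. f (?h p))"
    unfolding cube by (subst sum.reindex[OF inj]) simp
  also have "\<dots> = (\<Sum>s\<in>{-1, 1}. \<Sum>x\<in>hypercube N. f (x(Suc N := s)))"
    by (subst sum.cartesian_product) (simp add: case_prod_unfold)
  finally show ?thesis by (simp add: add.commute)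
qed

lemma cube_mean_Suc:
  "cube_mean (Suc N) f
     = (cube_mean N (restrict_last N 1 f) + cube_mean N (restrict_last N (-1) f)) / 2"
  by (simp add: cube_mean_def restrict_last_def sum_hypercube_Suc add_divide_distrib)

lemma cube_mean_add: "cube_mean N (\<lambda>x. f x + g x) = cube_mean N f + cube_mean N g"
  by (simp add: cube_mean_def sum.distrib add_divide_distrib)

lemma cube_mean_diff: "cube_mean N (\<lambda>x. f x - g x) = cube_mean N f - cube_mean N g"
  by (simp add: cube_mean_def sum_subtractf diff_divide_distrib)

lemma cube_mean_cmult: "cube_mean N (\<lambda>x. c * f x) = c * cube_mean N f"
  by (simp add: cube_mean_def sum_distrib_left)

lemma cube_mean_mono:
  assumes "\<And>x. x \<in> hypercube N \<Longrightarrow> f x \<le> g x"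
  shows "cube_mean N f \<le> cube_mean N g"
  unfolding cube_mean_def by (intro divide_right_mono sum_mono assms) auto

lemma cube_mean_nonneg:
  assumes "\<And>x. x \<in> hypercube N \<Longrightarrow> 0 \<le> f x"
  shows "0 \<le> cube_mean N f"
  unfolding cube_mean_def by (intro divide_nonneg_pos sum_nonneg assms) auto

lemma cube_mean_one: "cube_mean N (\<lambda>_. 1) = 1"
  by (induction N) (simp_all add: cube_mean_0 cube_mean_Suc restrict_last_def)

text \<open>The reverse triangle inequality for the \<open>L\<^sup>2\<close> norm, squared.\<close>

lemma sqrt_cube_mean_diff:
  "(sqrt (cube_mean N (\<lambda>x. (f x)\<^sup>2)) - sqrt (cube_mean N (\<lambda>x. (g x)\<^sup>2)))\<^sup>2
     \<le> cube_mean N (\<lambda>x. (f x - g x)\<^sup>2)"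
proof -
  let ?A = "cube_mean N (\<lambda>x. (f x)\<^sup>2)" and ?B = "cube_mean N (\<lambda>x. (g x)\<^sup>2)"
  have A: "0 \<le> ?A" and B: "0 \<le> ?B" by (auto intro: cube_mean_nonneg)
  have "(cube_mean N (\<lambda>x. f x * g x))\<^sup>2 \<le> ?A * ?B"
    unfolding cube_mean_def power_divide times_divide_times_eq power2_eq_square[of "2 ^ N :: real"]
    by (intro divide_right_mono Cauchy_Schwarz_ineq_sum) simp
  then have "cube_mean N (\<lambda>x. f x * g x) \<le> sqrt ?A * sqrt ?B"
    by (metis real_le_rsqrt real_sqrt_mult)
  moreover have "cube_mean N (\<lambda>x. (f x - g x)\<^sup>2) = ?A + ?B - 2 * cube_mean N (\<lambda>x. f x * g x)"
    by (simp add: power2_diff cube_mean_add cube_mean_diff cube_mean_cmult mult.assoc)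
  ultimately show ?thesis
    using A B by (simp add: power2_diff)
qed

section \<open>Fourier coefficients of the two halves of a cube\<close>

lemma fourier_coeff_eq_cube_mean:
  "fourier_coeff N f S = cube_mean N (\<lambda>x. f x * walsh S x)"
  by (simp add: fourier_coeff_def cube_mean_def)

lemma fourier_coeff_diff:
  "fourier_coeff N (\<lambda>x. f x - g x) S = fourier_coeff N f S - fourier_coeff N g S"
  by (simp add: fourier_coeff_eq_cube_mean left_diff_distrib cube_mean_diff)

lemma fourier_coeff_cmult:
  "fourier_coeff N (\<lambda>x. c * f x) S = c * fourier_coeff N f S"
  by (simp add: fourier_coeff_eq_cube_mean mult.assoc cube_mean_cmult)

lemma walsh_upd_notin:
  assumes "n \<notin> S" shows "walsh S (x(n := s)) = walsh S x"
  unfolding walsh_def using assms by (intro prod.cong) auto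

lemma walsh_upd_insert:
  assumes "finite S" "n \<notin> S" shows "walsh (insert n S) (x(n := s)) = s * walsh S x"
  using assms walsh_upd_notin[of n S x s] by (simp add: walsh_def)

lemma fourier_coeff_Suc_notin:
  assumes "S \<subseteq> {1..N}"
  shows "fourier_coeff (Suc N) f S
    = (fourier_coeff N (restrict_last N 1 f) S + fourier_coeff N (restrict_last N (-1) f) S) / 2"
proof -
  have "Suc N \<notin> S" using assms by auto
  then show ?thesis
    by (simp add: fourier_coeff_eq_cube_mean cube_mean_Suc restrict_last_def walsh_upd_notin)
qed

lemma fourier_coeff_Suc_insert:
  assumes "S \<subseteq> {1..N}"
  shows "fourier_coeff (Suc N) f (insert (Suc N) S)
    = (fourier_coeff N (restrict_last N 1 f) S - fourier_coeff N (restrict_last N (-1) f) S) / 2"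
proof -
  have "Suc N \<notin> S" "finite S" using assms by (auto intro: finite_subset)
  moreover have "cube_mean N (\<lambda>x. - h x) = - cube_mean N h" for h
    using cube_mean_cmult[of N "-1" h] by simp
  ultimately show ?thesis
    by (simp add: fourier_coeff_eq_cube_mean cube_mean_Suc restrict_last_def walsh_upd_insert)
qed

lemma sum_Pow_Suc:
  fixes F :: "nat set \<Rightarrow> real"
  shows "(\<Sum>S\<in>Pow {1..Suc N}. F S) = (\<Sum>S\<in>Pow {1..N}. F S + F (insert (Suc N) S))"
proof -
  have inj: "inj_on (insert (Suc N)) (Pow {1..N})"
    by (rule inj_onI) (metis PowD atLeastAtMost_iff insert_ident not_less_eq_eq order_refl subsetD)
  have "Pow {1..Suc N} = Pow {1..N} \<union> insert (Suc N) ` Pow {1..N}"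
    by (simp add: atLeastAtMostSuc_conv Pow_insert)
  moreover have "Pow {1..N} \<inter> insert (Suc N) ` Pow {1..N} = {}" by auto
  ultimately have "(\<Sum>S\<in>Pow {1..Suc N}. F S)
      = (\<Sum>S\<in>Pow {1..N}. F S) + (\<Sum>S\<in>insert (Suc N) ` Pow {1..N}. F S)"
    by (simp add: sum.union_disjoint)
  then show ?thesis
    by (simp only: sum.reindex[OF inj] sum.distrib comp_def)
qed

text \<open>
  Splitting off the last coordinate replaces a pair of coefficients \<open>a, b\<close> of the two halves
  by \<open>(a + b) / 2\<close> and \<open>(a - b) / 2\<close>, whose squares sum to the average of \<open>a\<^sup>2\<close> and \<open>b\<^sup>2\<close>.
\<close>

theorem parseval: "(\<Sum>S\<in>Pow {1..N}. (fourier_coeff N f S)\<^sup>2) = cube_mean N (\<lambda>x. (f x)\<^sup>2)"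
proof (induction N arbitrary: f)
  case 0
  show ?case by (simp add: fourier_coeff_eq_cube_mean cube_mean_0 walsh_def)
next
  case (Suc N)
  let ?a = "fourier_coeff N (restrict_last N 1 f)"
  let ?b = "fourier_coeff N (restrict_last N (-1) f)"
  have "(\<Sum>S\<in>Pow {1..Suc N}. (fourier_coeff (Suc N) f S)\<^sup>2)
      = (\<Sum>S\<in>Pow {1..N}. ((?a S + ?b S) / 2)\<^sup>2 + ((?a S - ?b S) / 2)\<^sup>2)"
    unfolding sum_Pow_Suc
    by (intro sum.cong refl) (simp add: fourier_coeff_Suc_notin fourier_coeff_Suc_insert)
  also have "\<dots> = (\<Sum>S\<in>Pow {1..N}. ((?a S)\<^sup>2 + (?b S)\<^sup>2) / 2)"
    by (intro sum.cong refl) (simp add: power2_eq_square field_simps)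
  also have "\<dots> = cube_mean (Suc N) (\<lambda>x. (f x)\<^sup>2)"
    unfolding sum_divide_distrib[symmetric] sum.distrib Suc.IH
    by (simp add: cube_mean_Suc restrict_last_def)
  finally show ?case .
qed

section \<open>The logarithmic Sobolev inequality\<close>

text \<open>
  This is the Dirichlet form of the random walk on the cube, equal to the sum over the
  coordinates \<open>k\<close> of the mean square of half the difference of \<open>f\<close> across direction \<open>k\<close>.
  The spectral form is used because it makes the dependence on the degree immediate.
\<close>

definition dirichlet_energy :: "nat \<Rightarrow> ((nat \<Rightarrow> real) \<Rightarrow> real) \<Rightarrow> real" where
  "dirichlet_energy N f = (\<Sum>S\<in>Pow {1..N}. real (card S) * (fourier_coeff N f S)\<^sup>2)"

text \<open>
  The sets containing \<open>Suc N\<close> have one more element than their traces on \<open>{1..N}\<close>. The extra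
  weight \<open>1\<close> collects the squared coefficients of half the difference of the two halves, which
  Parseval turns into a mean square.
\<close>

lemma dirichlet_energy_Suc:
  "dirichlet_energy (Suc N) f
    = (dirichlet_energy N (restrict_last N 1 f) + dirichlet_energy N (restrict_last N (-1) f)) / 2
      + cube_mean N (\<lambda>x. (restrict_last N 1 f x - restrict_last N (-1) f x)\<^sup>2) / 4"
proof -
  let ?f = "restrict_last N 1 f" and ?g = "restrict_last N (-1) f"
  let ?a = "fourier_coeff N ?f" and ?b = "fourier_coeff N ?g"
  have "dirichlet_energy (Suc N) f
      = (\<Sum>S\<in>Pow {1..N}. real (card S) * ((?a S + ?b S) / 2)\<^sup>2
            + (real (card S) + 1) * ((?a S - ?b S) / 2)\<^sup>2)"
    unfolding dirichlet_energy_def sum_Pow_Suc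
  proof (intro sum.cong refl)
    fix S assume "S \<in> Pow {1..N}"
    then have S: "S \<subseteq> {1..N}" by simp
    then have "card (insert (Suc N) S) = Suc (card S)"
      using finite_subset[OF S] by (intro card_insert_disjoint) auto
    then show "real (card S) * (fourier_coeff (Suc N) f S)\<^sup>2
          + real (card (insert (Suc N) S)) * (fourier_coeff (Suc N) f (insert (Suc N) S))\<^sup>2
        = real (card S) * ((?a S + ?b S) / 2)\<^sup>2 + (real (card S) + 1) * ((?a S - ?b S) / 2)\<^sup>2"
      using S by (simp add: fourier_coeff_Suc_notin fourier_coeff_Suc_insert)
  qed
  also have "\<dots> = (\<Sum>S\<in>Pow {1..N}. (real (card S) * (?a S)\<^sup>2 + real (card S) * (?b S)\<^sup>2) / 2
            + (fourier_coeff N (\<lambda>x. ?f x - ?g x) S)\<^sup>2 / 4)"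
    by (intro sum.cong refl) (simp add: fourier_coeff_diff power2_eq_square field_simps)
  also have "\<dots> = (dirichlet_energy N ?f + dirichlet_energy N ?g) / 2
      + (\<Sum>S\<in>Pow {1..N}. (fourier_coeff N (\<lambda>x. ?f x - ?g x) S)\<^sup>2) / 4"
    by (simp add: dirichlet_energy_def sum.distrib flip: sum_divide_distrib)
  finally show ?thesis unfolding parseval .
qed

text \<open>
  The right side minus the left side vanishes at \<open>t = 1\<close>, so it is enough that it is
  nonincreasing.
  With \<open>u = 1 / t - 1\<close>, its derivative is nonpositive exactly if \<open>1 + u + u\<^sup>2 / 2 \<le> exp u\<close>.
\<close>

lemma two_point_normalized:
  fixes t :: real
  assumes "0 \<le> t" "t \<le> 1"
  shows "t\<^sup>2 * ln t - (1 + t\<^sup>2) / 2 * ln ((1 + t\<^sup>2) / 2) \<le> (1 - t)\<^sup>2 / 2"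
proof (cases "t = 0")
  case True
  have "ln (2::real) \<le> 1" using ln_le_minus_one[of "2::real"] by simp
  then show ?thesis using True by (simp add: ln_div)
next
  case False
  define \<psi> where "\<psi> s = (1 - s)\<^sup>2 / 2 - s\<^sup>2 * ln s + (1 + s\<^sup>2) / 2 * ln ((1 + s\<^sup>2) / 2)" for s :: real
  have "\<psi> t \<ge> \<psi> 1"
  proof (rule DERIV_nonpos_imp_nonincreasing[OF assms(2)])
    fix s assume "t \<le> s" "s \<le> 1"
    then have s: "0 < s" "s \<le> 1" using assms False by auto
    have pos: "1 + s\<^sup>2 > 0" by (simp add: add_pos_nonneg)
    define u where "u = 1 / s - 1"
    have u: "0 \<le> u" using s by (simp add: u_def)
    have "(1 + s\<^sup>2) / 2 / s\<^sup>2 = 1 + u + u\<^sup>2 / 2"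
      using s by (simp add: u_def power2_eq_square field_simps)
    also have "\<dots> \<le> exp u" by (rule exp_lower_Taylor_quadratic[OF u])
    finally have "ln ((1 + s\<^sup>2) / 2 / s\<^sup>2) \<le> u"
      using s pos by (metis divide_pos_pos exp_gt_zero ln_exp ln_le_cancel_iff zero_less_numeral zero_less_power)
    then have "s * ln ((1 + s\<^sup>2) / 2 / s\<^sup>2) \<le> s * u"
      using s by (intro mult_left_mono) auto
    also have "s * u = 1 - s" using s by (simp add: u_def field_simps)
    finally have "s - 1 - 2 * s * ln s + s * ln ((1 + s\<^sup>2) / 2) \<le> 0"
      using s pos by (simp add: ln_div ln_mult ln_realpow algebra_simps)
    moreover have "(\<psi> has_real_derivative
        (s - 1 - 2 * s * ln s + s * ln ((1 + s\<^sup>2) / 2))) (at s)"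
    proof -
      define m where "m x = (1 + x\<^sup>2) / 2" for x :: real
      have m: "m s > 0" using pos by (simp add: m_def)
      have "(m has_real_derivative s) (at s)"
        unfolding m_def by (auto intro!: derivative_eq_intros)
      then have d2: "((\<lambda>x. m x * ln (m x)) has_real_derivative (s * ln (m s) + s)) (at s)"
        using m by (auto intro!: derivative_eq_intros)
      have d1: "((\<lambda>x. (1 - x)\<^sup>2 / 2 - x\<^sup>2 * ln x) has_real_derivative
          (- (1 - s) - (2 * s * ln s + s))) (at s)"
        using s by (auto intro!: derivative_eq_intros simp: power2_eq_square field_simps)
      show ?thesis
        unfolding \<psi>_def
        by (rule DERIV_cong[OF DERIV_add[OF d1 d2[unfolded m_def]]]) simp
    qed
    ultimately show "\<exists>y. (\<psi> has_real_derivative y) (at s) \<and> y \<le> 0" by blast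
  qed
  then show ?thesis by (simp add: \<psi>_def)
qed

text \<open>
  Both sides are homogeneous of degree \<open>2\<close> and symmetric, which reduces the inequality to
  the pair \<open>1, t\<close> with \<open>0 \<le> t \<le> 1\<close>. Zero values are covered because \<open>0 * ln 0 = 0\<close>.
\<close>

lemma two_point_log_sobolev:
  fixes a b :: real
  assumes "0 \<le> a" "0 \<le> b"
  shows "(a\<^sup>2 * ln (a\<^sup>2) + b\<^sup>2 * ln (b\<^sup>2)) / 2 - (a\<^sup>2 + b\<^sup>2) / 2 * ln ((a\<^sup>2 + b\<^sup>2) / 2)
           \<le> (a - b)\<^sup>2 / 2"
  using assms
proof (induction a b rule: linorder_wlog)
  case (sym a b)
  then show ?case by (simp add: add.commute power2_commute)
next
  case (le b a)
  show ?case
  proof (cases "a = 0")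
    case True
    then show ?thesis using le by simp
  next
    case False
    then have a: "a > 0" using le by simp
    define t where "t = b / a"
    have t: "0 \<le> t" "t \<le> 1" and b: "b = t * a"
      using le a by (auto simp: t_def)
    have pos: "1 + t\<^sup>2 > 0" by (simp add: add_pos_nonneg)
    have "(b\<^sup>2 + a\<^sup>2) / 2 = a\<^sup>2 * ((1 + t\<^sup>2) / 2)"
      by (simp add: b power2_eq_square field_simps)
    moreover have "ln (a\<^sup>2 * ((1 + t\<^sup>2) / 2)) = 2 * ln a + ln ((1 + t\<^sup>2) / 2)"
      using a pos by (subst ln_mult) (auto simp: ln_realpow)
    moreover have "b\<^sup>2 * ln (b\<^sup>2) = a\<^sup>2 * t\<^sup>2 * (2 * ln t + 2 * ln a)"
      using a t by (cases "t = 0") (auto simp: b ln_mult ln_realpow power2_eq_square)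
    moreover have "ln (a\<^sup>2) = 2 * ln a" using a by (simp add: ln_realpow)
    ultimately have "(b\<^sup>2 * ln (b\<^sup>2) + a\<^sup>2 * ln (a\<^sup>2)) / 2 - (b\<^sup>2 + a\<^sup>2) / 2 * ln ((b\<^sup>2 + a\<^sup>2) / 2)
        = a\<^sup>2 * (t\<^sup>2 * ln t - (1 + t\<^sup>2) / 2 * ln ((1 + t\<^sup>2) / 2))"
      by (simp add: field_simps)
    also have "\<dots> \<le> a\<^sup>2 * ((1 - t)\<^sup>2 / 2)"
      by (intro mult_left_mono two_point_normalized t) simp
    also have "\<dots> = (b - a)\<^sup>2 / 2"
      by (simp add: b power2_eq_square algebra_simps)
    finally show ?thesis .
  qed
qed

text \<open>
  The constant \<open>2\<close> does not grow with the dimension: in the inductive step the two-point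
  inequality is applied to the \<open>L\<^sup>2\<close> norms of the two halves, and the amount that it costs is
  bounded by twice the last term of \<open>dirichlet_energy_Suc\<close>.
\<close>

theorem log_sobolev:
  "cube_mean N (\<lambda>x. (f x)\<^sup>2 * ln ((f x)\<^sup>2))
     - cube_mean N (\<lambda>x. (f x)\<^sup>2) * ln (cube_mean N (\<lambda>x. (f x)\<^sup>2))
   \<le> 2 * dirichlet_energy N f"
proof (induction N arbitrary: f)
  case 0
  show ?case by (simp add: cube_mean_0 dirichlet_energy_def)
next
  case (Suc N)
  let ?f = "restrict_last N 1 f" and ?g = "restrict_last N (-1) f"
  let ?A = "cube_mean N (\<lambda>x. (?f x)\<^sup>2)" and ?B = "cube_mean N (\<lambda>x. (?g x)\<^sup>2)"
  have "0 \<le> ?A" "0 \<le> ?B" by (auto intro: cube_mean_nonneg)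
  then have "(?A * ln ?A + ?B * ln ?B) / 2 - (?A + ?B) / 2 * ln ((?A + ?B) / 2)
      \<le> (sqrt ?A - sqrt ?B)\<^sup>2 / 2"
    using two_point_log_sobolev[of "sqrt ?A" "sqrt ?B"] by simp
  also have "\<dots> \<le> cube_mean N (\<lambda>x. (?f x - ?g x)\<^sup>2) / 2"
    by (intro divide_right_mono sqrt_cube_mean_diff) simp
  finally have two_point: "(?A * ln ?A + ?B * ln ?B) / 2 - (?A + ?B) / 2 * ln ((?A + ?B) / 2)
      \<le> cube_mean N (\<lambda>x. (?f x - ?g x)\<^sup>2) / 2" .
  \<comment> \<open>The final estimate is linear in the entropies and energies, so they are made opaque.\<close>
  have combine: "(p + q) / 2 - z \<le> 2 * ((u + v) / 2 + w / 4)"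
    if "(a + b) / 2 - z \<le> w / 2" "p - a \<le> 2 * u" "q - b \<le> 2 * v" for p q a b u v w z :: real
    using that by (simp add: field_simps)
  have split: "cube_mean (Suc N) (\<lambda>x. h (f x))
      = (cube_mean N (\<lambda>x. h (?f x)) + cube_mean N (\<lambda>x. h (?g x))) / 2" for h
    by (simp add: cube_mean_Suc restrict_last_def)
  show ?case
    unfolding split[of "\<lambda>y. y\<^sup>2 * ln (y\<^sup>2)"] split[of "\<lambda>y. y\<^sup>2"] dirichlet_energy_Suc
    by (rule combine[OF two_point Suc.IH[of ?f] Suc.IH[of ?g]])
qed

section \<open>Comparison of the first two moments\<close>

text \<open>
  Jensen's inequality for the density \<open>g\<^sup>2\<close> is used through a tangent line of the logarithm,
  which keeps the zeros of \<open>g\<close> harmless: from \<open>ln u \<le> u - 1\<close> at \<open>u = c / \<bar>y\<bar>\<close> one gets a lower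
  bound for \<open>c \<bar>y\<bar>\<close> by a combination of \<open>y\<^sup>2\<close> and \<open>y\<^sup>2 ln y\<^sup>2\<close>.
\<close>

theorem L2_le_exp_degree_L1:
  assumes low: "\<And>S. S \<subseteq> {1..N} \<Longrightarrow> d < card S \<Longrightarrow> fourier_coeff N g S = 0"
  shows "sqrt (cube_mean N (\<lambda>x. (g x)\<^sup>2)) \<le> exp (real d) * cube_mean N (\<lambda>x. \<bar>g x\<bar>)"
proof (cases "cube_mean N (\<lambda>x. (g x)\<^sup>2) = 0")
  case True
  then show ?thesis by (auto intro!: mult_nonneg_nonneg cube_mean_nonneg)
next
  case False
  define M where "M = cube_mean N (\<lambda>x. (g x)\<^sup>2)"
  have "0 \<le> M" unfolding M_def by (auto intro: cube_mean_nonneg)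
  then have M: "M > 0" using False by (simp add: M_def)
  \<comment> \<open>With this contact point the entropy bound cancels \<open>ln c\<close> exactly, leaving \<open>M\<close>.\<close>
  define c where "c = exp (real d) * sqrt M"
  have c: "c > 0" using M by (simp add: c_def)
  have ln_c: "ln c = real d + ln M / 2"
    using M by (simp add: c_def ln_mult ln_sqrt)
  have "dirichlet_energy N g \<le> (\<Sum>S\<in>Pow {1..N}. real d * (fourier_coeff N g S)\<^sup>2)"
    unfolding dirichlet_energy_def
  proof (rule sum_mono)
    fix S assume "S \<in> Pow {1..N}"
    then show "real (card S) * (fourier_coeff N g S)\<^sup>2 \<le> real d * (fourier_coeff N g S)\<^sup>2"
      using low[of S] by (cases "d < card S") (auto intro: mult_right_mono)
  qed
  then have "dirichlet_energy N g \<le> real d * M"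
    unfolding sum_distrib_left[symmetric] parseval M_def .
  then have entropy: "cube_mean N (\<lambda>x. (g x)\<^sup>2 * ln ((g x)\<^sup>2)) \<le> M * ln M + 2 * (real d * M)"
    using log_sobolev[of N g] by (simp add: M_def)
  have tangent: "(1 + ln c) * y\<^sup>2 - 1 / 2 * (y\<^sup>2 * ln (y\<^sup>2)) \<le> c * \<bar>y\<bar>" for y
  proof (cases "y = 0")
    case False
    have "ln (c / \<bar>y\<bar>) \<le> c / \<bar>y\<bar> - 1" using c False by (intro ln_le_minus_one) simp
    then have "y\<^sup>2 * (1 + ln (c / \<bar>y\<bar>)) \<le> y\<^sup>2 * (c / \<bar>y\<bar>)" by (intro mult_left_mono) auto
    moreover have "y\<^sup>2 * (c / \<bar>y\<bar>) = c * \<bar>y\<bar>"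
      using False by (simp add: power2_eq_square field_simps abs_if)
    moreover have "ln (c / \<bar>y\<bar>) = ln c - ln (y\<^sup>2) / 2"
      using c False ln_realpow[of "\<bar>y\<bar>" 2] by (simp add: ln_div)
    ultimately show ?thesis by (simp add: algebra_simps)
  qed simp
  have "M \<le> (1 + ln c) * M - 1 / 2 * cube_mean N (\<lambda>x. (g x)\<^sup>2 * ln ((g x)\<^sup>2))"
    using entropy by (simp add: ln_c algebra_simps)
  also have "\<dots> = cube_mean N (\<lambda>x. (1 + ln c) * (g x)\<^sup>2 - 1 / 2 * ((g x)\<^sup>2 * ln ((g x)\<^sup>2)))"
    unfolding M_def cube_mean_diff cube_mean_cmult ..
  also have "\<dots> \<le> cube_mean N (\<lambda>x. c * \<bar>g x\<bar>)"
    by (intro cube_mean_mono tangent)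
  also have "\<dots> = sqrt M * (exp (real d) * cube_mean N (\<lambda>x. \<bar>g x\<bar>))"
    by (simp add: cube_mean_cmult c_def)
  finally have "sqrt M * sqrt M \<le> sqrt M * (exp (real d) * cube_mean N (\<lambda>x. \<bar>g x\<bar>))"
    using M by simp
  moreover have "0 < sqrt M" using M by simp
  ultimately have "sqrt M \<le> exp (real d) * cube_mean N (\<lambda>x. \<bar>g x\<bar>)"
    by (rule mult_left_le_imp_le)
  then show ?thesis by (simp only: M_def)
qed

section \<open>Bounded functions of low degree\<close>

lemma fourier_coeff_eq_0_of_cube_degree_less:
  assumes "S \<subseteq> {1..N}" "cube_degree N f < card S"
  shows "fourier_coeff N f S = 0"
proof (cases "\<forall>x\<in>hypercube N. f x = 0")
  case True
  then show ?thesis by (simp add: fourier_coeff_def)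
next
  case False
  let ?D = "{card S |S. S \<subseteq> {1..N} \<and> fourier_coeff N f S \<noteq> 0}"
  have "finite ?D"
    by (rule finite_subset[of _ "card ` Pow {1..N}"]) auto
  moreover have "Max ?D < card S"
    using assms(2) unfolding cube_degree_def if_not_P[OF False] .
  ultimately show ?thesis using assms(1) Max_ge[of ?D "card S"] by fastforce
qed

text \<open>
  The coefficient of the constant \<open>1\<close> at the empty set is \<open>1\<close> and already exhausts its
  mean square, so Parseval leaves nothing for the other sets.
\<close>

lemma fourier_coeff_one:
  assumes "S \<subseteq> {1..N}" "S \<noteq> {}"
  shows "fourier_coeff N (\<lambda>_. 1) S = 0"
proof -
  have "(\<Sum>T\<in>Pow {1..N}. (fourier_coeff N (\<lambda>_. 1) T)\<^sup>2) = 1"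
    using parseval[of N "\<lambda>_. 1"] by (simp add: cube_mean_one)
  moreover have "(\<Sum>T\<in>{{}, S}. (fourier_coeff N (\<lambda>_. 1) T)\<^sup>2)
      \<le> (\<Sum>T\<in>Pow {1..N}. (fourier_coeff N (\<lambda>_. 1) T)\<^sup>2)"
    using assms by (intro sum_mono2) auto
  ultimately show ?thesis
    using assms by (simp add: fourier_coeff_eq_cube_mean[of N _ "{}"] walsh_def cube_mean_one)
qed

theorem corollary4p5:
  fixes N d :: nat and f :: "(nat \<Rightarrow> real) \<Rightarrow> real"
  assumes "N \<ge> 1"
    and "f \<in> hypercube N \<rightarrow> {-1..1}"
    and "cube_degree N f = d"
  shows "sqrt (\<Sum>S\<in>{S. S \<subseteq> {1..N} \<and> 0 < card S \<and> card S \<le> d}. \<bar>fourier_coeff N f S\<bar>\<^sup>2)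
           \<le> 2 * exp (real d) * (1 - \<bar>fourier_coeff N f {}\<bar>)"
proof -
  define \<sigma> :: real where "\<sigma> = (if fourier_coeff N f {} \<ge> 0 then 1 else -1)"
  define g where "g x = 1 - \<sigma> * f x" for x
  have coeff: "fourier_coeff N g S = fourier_coeff N (\<lambda>_. 1) S - \<sigma> * fourier_coeff N f S" for S
    unfolding g_def fourier_coeff_diff fourier_coeff_cmult ..
  have g_nonneg: "0 \<le> g x" if "x \<in> hypercube N" for x
    using assms(2) that by (auto simp: g_def \<sigma>_def Pi_def)
  have "cube_mean N (\<lambda>x. \<bar>g x\<bar>) = cube_mean N g"
    using g_nonneg by (simp add: cube_mean_def)
  also have "\<dots> = fourier_coeff N g {}"
    by (simp add: fourier_coeff_eq_cube_mean walsh_def)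
  also have "\<dots> = 1 - \<bar>fourier_coeff N f {}\<bar>"
    by (simp add: coeff \<sigma>_def) (simp add: fourier_coeff_eq_cube_mean walsh_def cube_mean_one)
  finally have L1: "cube_mean N (\<lambda>x. \<bar>g x\<bar>) = 1 - \<bar>fourier_coeff N f {}\<bar>" .
  have low: "fourier_coeff N g S = 0" if "S \<subseteq> {1..N}" "d < card S" for S
    using that assms(3) fourier_coeff_eq_0_of_cube_degree_less[of S N f] fourier_coeff_one[of S N]
    by (cases "S = {}") (auto simp: coeff)
  have "(\<Sum>S\<in>{S. S \<subseteq> {1..N} \<and> 0 < card S \<and> card S \<le> d}. \<bar>fourier_coeff N f S\<bar>\<^sup>2)
      = (\<Sum>S\<in>{S. S \<subseteq> {1..N} \<and> 0 < card S \<and> card S \<le> d}. (fourier_coeff N g S)\<^sup>2)"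
  proof (intro sum.cong refl)
    fix S assume S: "S \<in> {S. S \<subseteq> {1..N} \<and> 0 < card S \<and> card S \<le> d}"
    then have "fourier_coeff N (\<lambda>_. 1) S = 0" by (intro fourier_coeff_one) auto
    then show "\<bar>fourier_coeff N f S\<bar>\<^sup>2 = (fourier_coeff N g S)\<^sup>2"
      by (simp add: coeff \<sigma>_def)
  qed
  also have "\<dots> \<le> (\<Sum>S\<in>Pow {1..N}. (fourier_coeff N g S)\<^sup>2)"
    by (intro sum_mono2) auto
  also have "\<dots> = cube_mean N (\<lambda>x. (g x)\<^sup>2)" by (rule parseval)
  finally have "sqrt (\<Sum>S\<in>{S. S \<subseteq> {1..N} \<and> 0 < card S \<and> card S \<le> d}. \<bar>fourier_coeff N f S\<bar>\<^sup>2)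
      \<le> sqrt (cube_mean N (\<lambda>x. (g x)\<^sup>2))" by simp
  also have "\<dots> \<le> exp (real d) * cube_mean N (\<lambda>x. \<bar>g x\<bar>)"
    by (rule L2_le_exp_degree_L1[OF low])
  also have "\<dots> \<le> 2 * (exp (real d) * cube_mean N (\<lambda>x. \<bar>g x\<bar>))"
    using cube_mean_nonneg[of N "\<lambda>x. \<bar>g x\<bar>"] by simp
  finally show ?thesis unfolding L1 by (simp add: mult.assoc)
qed

end
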